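(* Let $n\geq 2$ and let $\mathcal{G}=(\mathcal{V},\mathcal{E})$ be a directed graph on $\mathcal{V}=\{1,\ldots,n\}$ in which every node has at least one outgoing edge, with hyperlink matrix $A$, let $m\in(0,1)$, and let $x^*$ be the PageRank vector. Consider the following randomized algorithm. Initially $x_i(0)=z_i(0)=m/n$ for all $i\in\mathcal{V}$. At each time $k\geq 0$, a page $\theta(k)\in\mathcal{V}$ is selected, the sequence $\{\theta(k)\}$ being i.i.d. with $\mathrm{Prob}\{\theta(k)=i\}=1/n$ for every $i\in\mathcal{V}$, and each page $i\in\mathcal{V}$ updates $$x_i(k+1)=\begin{cases}x_i(k)+\frac{1-m}{n_{\theta(k)}}z_{\theta(k)}(k)&\text{if } i\in\mathcal{L}^{\text{out}}_{\theta(k)},\\ x_i(k)&\text{otherwise,}\end{cases}$$ $$z_i(k+1)=\begin{cases}0&\text{if } i=\theta(k),\\ z_i(k)+\frac{1-m}{n_{\theta(k)}}z_{\theta(k)}(k)&\text{if } i\in\mathcal{L}^{\text{out}}_{\theta(k)},\\ z_i(k)&\text{otherwise.}\end{cases}$$ Then $x(k)\to x^*$ as $k\to\infty$ with probability $1$. Moreover: (i) $x(k)\leq x(k+1)\leq x^*$ for all $k\geq 0$; (ii) $\mathbb{E}[x(k)]\to x^*$ as $k\to\infty$, and this convergence is exponential, i.e., there exist $C>0$ and $\rho\in(0,1)$ with $\|\mathbb{E}[x(k)]-x^*\|\leq C\rho^k$ for all $k\geq 0$.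
   Context: Write $(i,j)\in\mathcal{E}$ if page $i$ has a link to page $j$. $\mathcal{L}_j^{\text{out}}=\{i:(j,i)\in\mathcal{E}\}$ and $n_j=|\mathcal{L}_j^{\text{out}}|\geq 1$. The hyperlink matrix $A=(a_{ij})$ is defined by $a_{ij}=1/n_j$ if $i\in\mathcal{L}_j^{\text{out}}$ and $a_{ij}=0$ otherwise (column stochastic). The PageRank vector $x^*$ satisfies $x^*=(1-m)Ax^*+\frac{m}{n}\mathbf{1}_n$ and $\mathbf{1}_n^Tx^*=1$. Here $x(k)=(x_1(k),\ldots,x_n(k))^T$; inequalities between vectors are entrywise.
   Formalization: The graph is additionally assumed to have no self-links (no page links to itself); with a self-link the stated update loses mass and x(k) does not converge to x*, e.g. n=2 where each page links only to itself. *)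

theory Defs
  imports "HOL-Probability.Probability"
begin

text \<open>Pages are indexed by 0,...,n-1 (instead of 1,...,n). The out-link set of page j
  is L j, so n_j = card (L j).\<close>

definition hyperlink :: "(nat \<Rightarrow> nat set) \<Rightarrow> nat \<Rightarrow> nat \<Rightarrow> real" where
  "hyperlink L i j = (if i \<in> L j then 1 / real (card (L j)) else 0)"

fun pr_state :: "nat \<Rightarrow> (nat \<Rightarrow> nat set) \<Rightarrow> real \<Rightarrow> (nat \<Rightarrow> nat) \<Rightarrow> nat
    \<Rightarrow> (nat \<Rightarrow> real) \<times> (nat \<Rightarrow> real)" where
  "pr_state n L m th 0 = (\<lambda>i. m / real n, \<lambda>i. m / real n)"
| "pr_state n L m th (Suc k) =
     (let x = fst (pr_state n L m th k); z = snd (pr_state n L m th k); j = th k;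
          d = (1 - m) / real (card (L j)) * z j
      in (\<lambda>i. if i \<in> L j then x i + d else x i,
          \<lambda>i. if i = j then 0 else if i \<in> L j then z i + d else z i))"

abbreviation pr_x :: "nat \<Rightarrow> (nat \<Rightarrow> nat set) \<Rightarrow> real \<Rightarrow> (nat \<Rightarrow> nat) \<Rightarrow> nat \<Rightarrow> nat \<Rightarrow> real" where
  "pr_x n L m th k \<equiv> fst (pr_state n L m th k)"

end

theory Submission
  imports Defs
begin

text \<open>
  Let \<open>Q = (1 - m) A\<close> and let \<open>w(k) = (x\<^sup>* - x(k)) + z(k)\<close>. Selecting page \<open>j\<close> changes \<open>w\<close> only
  by subtracting \<open>z\<^sub>j(k)\<close> from its \<open>j\<close>-th entry, which preserves the identity
  \<open>x\<^sup>* - x(k) = Q w(k)\<close>. Hence \<open>w = Q w + z\<close> with \<open>z \<ge> 0\<close>; as the columns of \<open>Q\<close> sum to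
  \<open>1 - m < 1\<close>, this forces \<open>w \<ge> 0\<close>, so \<open>x(k) \<le> x\<^sup>*\<close>, and summing entries gives
  \<open>1\<^sup>T z = m 1\<^sup>T w\<close>. Since \<open>\<theta>(k)\<close> is uniform and independent of the state at time \<open>k\<close>, the
  expectation of \<open>1\<^sup>T w(k)\<close> is therefore multiplied by exactly \<open>1 - m/n\<close> at each step. This
  total dominates every entry of \<open>x\<^sup>* - x(k)\<close>, which yields the exponential rate, and its
  expectations are summable, which yields almost sure convergence.
\<close>

abbreviation pr_z :: "nat \<Rightarrow> (nat \<Rightarrow> nat set) \<Rightarrow> real \<Rightarrow> (nat \<Rightarrow> nat) \<Rightarrow> nat \<Rightarrow> nat \<Rightarrow> real" where
  "pr_z n L m th k \<equiv> snd (pr_state n L m th k)"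

section \<open>Dependence of the state on the selections\<close>

text \<open>Step \<open>t\<close> reads only \<open>f t\<close>. This locality later makes the state
  at time \<open>k\<close> independent of the selection at time \<open>k\<close>.\<close>

lemma pr_state_cong:
  assumes "\<And>t. t < k \<Longrightarrow> f t = g t"
  shows "pr_state n L m f k = pr_state n L m g k"
  using assms by (induction k) (auto simp: Let_def)

text \<open>\<open>N\<close> is arbitrary and only \<open>g t\<close> with \<open>t < k\<close> is
  constrained, so that the result covers both the probability space and the finite product space
  over the coordinates below \<open>k\<close>.\<close>

lemma measurable_pr_state:
  assumes "\<And>t. t < k \<Longrightarrow> g t \<in> measurable N (count_space UNIV)"
  shows "(\<lambda>\<omega>. pr_x n L m (\<lambda>t. g t \<omega>) k i) \<in> borel_measurable N"
    and "(\<lambda>\<omega>. pr_z n L m (\<lambda>t. g t \<omega>) k i) \<in> borel_measurable N"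
proof -
  have "(\<forall>i. (\<lambda>\<omega>. pr_x n L m (\<lambda>t. g t \<omega>) k i) \<in> borel_measurable N)
      \<and> (\<forall>i. (\<lambda>\<omega>. pr_z n L m (\<lambda>t. g t \<omega>) k i) \<in> borel_measurable N)"
    using assms
  proof (induction k)
    case 0
    then show ?case by simp
  next
    case (Suc k)
    have x: "\<And>i. (\<lambda>\<omega>. pr_x n L m (\<lambda>t. g t \<omega>) k i) \<in> borel_measurable N"
      and z: "\<And>i. (\<lambda>\<omega>. pr_z n L m (\<lambda>t. g t \<omega>) k i) \<in> borel_measurable N"
      using Suc by simp_all
    have g: "g k \<in> measurable N (count_space UNIV)"
      using Suc.prems by simp
    have "(\<lambda>\<omega>. pr_x n L m (\<lambda>t. g t \<omega>) (Suc k) i) \<in> borel_measurable N" for i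
    proof -
      \<comment> \<open>\<open>?f j\<close> is the update with the selected page frozen at
        \<open>j\<close>; page indices are countable, so measurability for each \<open>j\<close>
        suffices.\<close>
      let ?f = "\<lambda>j \<omega>. if i \<in> L j
        then pr_x n L m (\<lambda>t. g t \<omega>) k i
          + (1 - m) / real (card (L j)) * pr_z n L m (\<lambda>t. g t \<omega>) k j
        else pr_x n L m (\<lambda>t. g t \<omega>) k i"
      have "?f j \<in> borel_measurable N" for j
        using x z by (cases "i \<in> L j") simp_all
      from measurable_compose_countable[OF this g]
      show ?thesis by (simp add: Let_def if_distrib[where f="\<lambda>h. h i"] cong: if_cong)
    qed
    moreover have "(\<lambda>\<omega>. pr_z n L m (\<lambda>t. g t \<omega>) (Suc k) i) \<in> borel_measurable N" for i
    proof -
      let ?f = "\<lambda>j \<omega>. if i = j then 0 else if i \<in> L j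
        then pr_z n L m (\<lambda>t. g t \<omega>) k i
          + (1 - m) / real (card (L j)) * pr_z n L m (\<lambda>t. g t \<omega>) k j
        else pr_z n L m (\<lambda>t. g t \<omega>) k i"
      have "?f j \<in> borel_measurable N" for j
        using z by (cases "i = j"; cases "i \<in> L j") simp_all
      from measurable_compose_countable[OF this g]
      show ?thesis by (simp add: Let_def cong: if_cong)
    qed
    ultimately show ?case by blast
  qed
  then show "(\<lambda>\<omega>. pr_x n L m (\<lambda>t. g t \<omega>) k i) \<in> borel_measurable N"
    and "(\<lambda>\<omega>. pr_z n L m (\<lambda>t. g t \<omega>) k i) \<in> borel_measurable N"
    by auto
qed

section \<open>The matrix \<open>Q\<close> and the one-step recursions\<close>

locale pagerank_graph =
  fixes n :: nat and L :: "nat \<Rightarrow> nat set" and m :: real and xs :: "nat \<Rightarrow> real"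
  assumes n_pos: "0 < n"
    and out_subset: "\<And>j. j < n \<Longrightarrow> L j \<subseteq> {..<n}"
    and out_nonempty: "\<And>j. j < n \<Longrightarrow> L j \<noteq> {}"
    and no_loop: "\<And>j. j < n \<Longrightarrow> j \<notin> L j"
    and m_pos: "0 < m" and m_less_1: "m < 1"
    and pagerank_eq: "\<And>i. i < n \<Longrightarrow> xs i = (1 - m) * (\<Sum>j<n. hyperlink L i j * xs j) + m / real n"
    and pagerank_total: "(\<Sum>i<n. xs i) = 1"
begin

definition Q :: "nat \<Rightarrow> nat \<Rightarrow> real" where
  "Q i j = (1 - m) * hyperlink L i j"

definition w :: "(nat \<Rightarrow> nat) \<Rightarrow> nat \<Rightarrow> nat \<Rightarrow> real" where
  "w th k i = xs i - pr_x n L m th k i + pr_z n L m th k i"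

lemma Q_nonneg: "0 \<le> Q i j"
  using m_less_1 by (simp add: Q_def hyperlink_def)

lemma Q_diag: "j < n \<Longrightarrow> Q j j = 0"
  using no_loop by (simp add: Q_def hyperlink_def)

lemma sum_Q_column:
  assumes "j < n"
  shows "(\<Sum>i<n. Q i j) = 1 - m"
proof -
  have fin: "finite (L j)"
    using out_subset[OF assms] finite_subset by blast
  have "(\<Sum>i<n. hyperlink L i j) = (\<Sum>i\<in>{..<n} \<inter> L j. 1 / real (card (L j)))"
    unfolding hyperlink_def by (rule sum.inter_restrict[symmetric]) simp
  also have "{..<n} \<inter> L j = L j"
    using out_subset[OF assms] by blast
  also have "(\<Sum>i\<in>L j. 1 / real (card (L j))) = 1"
    using fin out_nonempty[OF assms] by simp
  finally show ?thesis
    by (simp add: Q_def flip: sum_distrib_left)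
qed

lemma sum_Q_mult: "(\<Sum>i<n. \<Sum>j<n. Q i j * v j) = (1 - m) * (\<Sum>j<n. v j)"
proof -
  have "(\<Sum>i<n. \<Sum>j<n. Q i j * v j) = (\<Sum>j<n. (\<Sum>i<n. Q i j) * v j)"
    by (subst sum.swap) (simp add: sum_distrib_right)
  then show ?thesis
    by (simp add: sum_Q_column sum_distrib_left)
qed

text \<open>A minimum principle: the negative part \<open>p\<close> of \<open>v\<close> satisfies
  \<open>p \<le> Q p\<close>, but \<open>Q\<close> shrinks the total of a vector by the factor
  \<open>1 - m\<close>, so \<open>p\<close> must vanish.\<close>

lemma nonneg_if_Q_supersolution:
  assumes "\<And>i. i < n \<Longrightarrow> (\<Sum>j<n. Q i j * v j) \<le> v i"
    and "i < n"
  shows "0 \<le> v i"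
proof -
  define p where "p i = max 0 (- v i)" for i
  have p_nonneg: "0 \<le> p i" for i
    by (simp add: p_def)
  have "p i \<le> (\<Sum>j<n. Q i j * p j)" if "i < n" for i
  proof -
    have "- (\<Sum>j<n. Q i j * v j) \<le> (\<Sum>j<n. Q i j * p j)"
      unfolding sum_negf[symmetric] mult_minus_right[symmetric]
      by (intro sum_mono mult_left_mono Q_nonneg) (simp add: p_def)
    moreover have "0 \<le> (\<Sum>j<n. Q i j * p j)"
      by (intro sum_nonneg mult_nonneg_nonneg Q_nonneg p_nonneg)
    ultimately show ?thesis
      using assms(1)[OF that] by (simp add: p_def)
  qed
  then have "(\<Sum>i<n. p i) \<le> (\<Sum>i<n. \<Sum>j<n. Q i j * p j)"
    by (intro sum_mono) simp
  then have "m * (\<Sum>i<n. p i) \<le> 0"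
    unfolding sum_Q_mult by (simp add: algebra_simps)
  then have "(\<Sum>i<n. p i) \<le> 0"
    using m_pos by (simp add: mult_le_0_iff)
  moreover have "p i \<le> (\<Sum>i<n. p i)"
    using assms(2) p_nonneg by (intro member_le_sum) auto
  ultimately show ?thesis
    by (simp add: p_def)
qed

lemma pr_x_Suc:
  "pr_x n L m th (Suc k) i = pr_x n L m th k i + Q i (th k) * pr_z n L m th k (th k)"
  by (simp add: Let_def Q_def hyperlink_def)

text \<open>Since no page links to itself, \<open>Q j j = 0\<close>, and resetting the selected
  entry to 0 amounts to subtracting its old value. This turns the three cases into one linear
  formula.\<close>

lemma pr_z_Suc:
  assumes "th k < n"
  shows "pr_z n L m th (Suc k) i = pr_z n L m th k i + Q i (th k) * pr_z n L m th k (th k)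
    - (if i = th k then pr_z n L m th k (th k) else 0)"
  using Q_diag[OF assms] by (simp add: Let_def Q_def hyperlink_def)

text \<open>\<open>x\<close> and \<open>z\<close> receive the same increment
  \<open>Q i (th k) * z\<close>, which cancels in \<open>w\<close>; only the reset of the selected
  entry remains.\<close>

lemma w_Suc:
  assumes "th k < n"
  shows "w th (Suc k) i = w th k i - (if i = th k then pr_z n L m th k (th k) else 0)"
  using assms by (simp only: w_def pr_x_Suc pr_z_Suc)

text \<open>\<open>x\<close> and \<open>z\<close> start equal, so \<open>w\<close> starts at
  \<open>xs\<close>.\<close>

lemma sum_w_0: "(\<Sum>i<n. w th 0 i) = 1"
  by (simp add: w_def pagerank_total)

lemma sum_w_Suc:
  assumes "th k < n"
  shows "(\<Sum>i<n. w th (Suc k) i) = (\<Sum>i<n. w th k i) - pr_z n L m th k (th k)"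
  using assms by (simp add: w_Suc sum_subtractf)

section \<open>Bounds along a fixed selection sequence\<close>

context
  fixes th :: "nat \<Rightarrow> nat"
  assumes th_less: "\<And>t. th t < n"
begin

lemma pr_z_nonneg: "0 \<le> pr_z n L m th k i"
proof (induction k arbitrary: i)
  case 0
  then show ?case using m_pos by simp
next
  case (Suc k)
  then show ?case using m_less_1 by (auto simp: Let_def)
qed

lemma pr_x_mono: "pr_x n L m th k i \<le> pr_x n L m th (Suc k) i"
  unfolding pr_x_Suc by (simp add: Q_nonneg pr_z_nonneg)

lemma pr_x_nonneg: "0 \<le> pr_x n L m th k i"
proof (induction k)
  case 0
  then show ?case using m_pos by simp
next
  case (Suc k)
  then show ?case using pr_x_mono[of k i] by linarith
qed

text \<open>At time 0, \<open>w\<close> is \<open>xs\<close> and this is the PageRank equation with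
  \<open>x = m/n\<close>. Each step then lowers both sides by \<open>Q i (th k)\<close> times the
  selected entry of \<open>z\<close>.\<close>

lemma error_eq_Q_w:
  assumes "i < n"
  shows "xs i - pr_x n L m th k i = (\<Sum>j<n. Q i j * w th k j)"
proof (induction k)
  case 0
  have "(\<Sum>j<n. Q i j * xs j) = (1 - m) * (\<Sum>j<n. hyperlink L i j * xs j)"
    by (simp add: Q_def sum_distrib_left mult.assoc)
  then show ?case
    using pagerank_eq[OF assms] by (simp add: w_def)
next
  case (Suc k)
  have "(\<Sum>j<n. Q i j * w th (Suc k) j)
      = (\<Sum>j<n. Q i j * w th k j - (if j = th k then Q i j * pr_z n L m th k (th k) else 0))"
    by (rule sum.cong) (auto simp: w_Suc th_less algebra_simps)
  also have "\<dots> = (\<Sum>j<n. Q i j * w th k j) - Q i (th k) * pr_z n L m th k (th k)"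
    using th_less[of k] by (simp add: sum_subtractf)
  finally show ?case
    using Suc by (simp only: pr_x_Suc)
qed

text \<open>\<open>Q w\<close> is the error \<open>xs - x\<close>, that is \<open>w - z\<close>,
  hence at most \<open>w\<close>; the minimum principle applies.\<close>

lemma w_nonneg: "i < n \<Longrightarrow> 0 \<le> w th k i"
proof (rule nonneg_if_Q_supersolution[where v="w th k"])
  fix i assume "i < n"
  show "(\<Sum>j<n. Q i j * w th k j) \<le> w th k i"
    using error_eq_Q_w[OF \<open>i < n\<close>, of k] pr_z_nonneg[of k i] by (simp add: w_def)
qed

lemma pr_x_le_pagerank:
  assumes "i < n"
  shows "pr_x n L m th k i \<le> xs i"
proof -
  have "0 \<le> (\<Sum>j<n. Q i j * w th k j)"
    by (intro sum_nonneg mult_nonneg_nonneg Q_nonneg w_nonneg) simp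
  then show ?thesis
    using error_eq_Q_w[OF assms, of k] by simp
qed

text \<open>Summing \<open>w = Q w + z\<close>: the term \<open>Q w\<close> carries the share
  \<open>1 - m\<close> of the total, leaving \<open>m\<close> for \<open>z\<close>.\<close>

lemma sum_pr_z: "(\<Sum>i<n. pr_z n L m th k i) = m * (\<Sum>i<n. w th k i)"
proof -
  have "(\<Sum>i<n. xs i - pr_x n L m th k i) = (1 - m) * (\<Sum>i<n. w th k i)"
    unfolding sum_Q_mult[symmetric] by (intro sum.cong refl error_eq_Q_w) simp
  moreover have "(\<Sum>i<n. w th k i)
      = (\<Sum>i<n. xs i - pr_x n L m th k i) + (\<Sum>i<n. pr_z n L m th k i)"
    by (simp add: w_def sum.distrib)
  ultimately show ?thesis
    by (simp add: algebra_simps)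
qed

lemma sum_w_nonneg: "0 \<le> (\<Sum>i<n. w th k i)"
  by (intro sum_nonneg w_nonneg) simp

lemma sum_w_le_1: "(\<Sum>i<n. w th k i) \<le> 1"
proof (induction k)
  case 0
  then show ?case by (simp add: sum_w_0)
next
  case (Suc k)
  then show ?case
    using pr_z_nonneg[of k "th k"] by (simp add: sum_w_Suc th_less)
qed

text \<open>The error is \<open>w - z \<le> w\<close>, and an entry of the nonnegative
  \<open>w\<close> is at most the total.\<close>

lemma error_le_sum_w:
  assumes "i < n"
  shows "xs i - pr_x n L m th k i \<le> (\<Sum>i<n. w th k i)"
proof -
  have "w th k i \<le> (\<Sum>i<n. w th k i)"
    using assms w_nonneg by (intro member_le_sum) auto
  then show ?thesis
    using pr_z_nonneg[of k i] by (simp add: w_def)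
qed

text \<open>\<open>z\<close> is \<open>w\<close> minus a nonnegative error, and the total of
  \<open>w\<close> never exceeds its initial value 1. The uniform bound serves
  integrability.\<close>

lemma pr_z_le_1:
  assumes "i < n"
  shows "pr_z n L m th k i \<le> 1"
proof -
  have "w th k i \<le> (\<Sum>i<n. w th k i)"
    using assms w_nonneg by (intro member_le_sum) auto
  then show ?thesis
    using pr_x_le_pagerank[OF assms, of k] sum_w_le_1[of k] by (simp add: w_def)
qed

end

end

section \<open>Random selections: measurability and integrability\<close>

locale random_pagerank = pagerank_graph n L m xs + prob_space M
  for n L m xs and M :: "'a measure" +
  fixes th :: "nat \<Rightarrow> 'a \<Rightarrow> nat"
  assumes th_measurable: "\<And>k. th k \<in> measurable M (count_space UNIV)"
    and th_less_n: "\<And>k \<omega>. \<omega> \<in> space M \<Longrightarrow> th k \<omega> < n"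
    and th_indep_vars: "indep_vars (\<lambda>_. count_space UNIV) th UNIV"
    and th_uniform: "\<And>k i. i < n \<Longrightarrow> prob {\<omega> \<in> space M. th k \<omega> = i} = 1 / real n"
begin

abbreviation sel :: "'a \<Rightarrow> nat \<Rightarrow> nat" where
  "sel \<omega> \<equiv> \<lambda>t. th t \<omega>"

text \<open>The potential that majorizes every entry of the error and whose mean can be computed
  exactly.\<close>

definition S :: "nat \<Rightarrow> 'a \<Rightarrow> real" where
  "S k \<omega> = (\<Sum>i<n. w (sel \<omega>) k i)"

lemma pr_x_measurable [measurable]:
  "(\<lambda>\<omega>. pr_x n L m (sel \<omega>) k i) \<in> borel_measurable M"
  by (intro measurable_pr_state th_measurable)

lemma pr_z_measurable [measurable]:
  "(\<lambda>\<omega>. pr_z n L m (sel \<omega>) k i) \<in> borel_measurable M"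
  by (intro measurable_pr_state th_measurable)

lemma S_measurable [measurable]: "S k \<in> borel_measurable M"
  unfolding S_def w_def by measurable

lemma S_nonneg: "\<omega> \<in> space M \<Longrightarrow> 0 \<le> S k \<omega>"
  unfolding S_def by (intro sum_w_nonneg th_less_n)

lemma integrable_pr_x:
  assumes "i < n"
  shows "integrable M (\<lambda>\<omega>. pr_x n L m (sel \<omega>) k i)"
proof (rule integrable_const_bound[where B="xs i"])
  show "AE \<omega> in M. norm (pr_x n L m (sel \<omega>) k i) \<le> xs i"
  proof (rule AE_I2)
    fix \<omega> assume "\<omega> \<in> space M"
    then have sel: "\<And>t. sel \<omega> t < n" by (rule th_less_n)
    show "norm (pr_x n L m (sel \<omega>) k i) \<le> xs i"
      using pr_x_nonneg[of "sel \<omega>", OF sel] pr_x_le_pagerank[of "sel \<omega>", OF sel assms] by simp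
  qed
qed (rule pr_x_measurable)

lemma integrable_pr_z:
  assumes "i < n"
  shows "integrable M (\<lambda>\<omega>. pr_z n L m (sel \<omega>) k i)"
proof (rule integrable_const_bound[where B=1])
  show "AE \<omega> in M. norm (pr_z n L m (sel \<omega>) k i) \<le> 1"
  proof (rule AE_I2)
    fix \<omega> assume "\<omega> \<in> space M"
    then have sel: "\<And>t. sel \<omega> t < n" by (rule th_less_n)
    show "norm (pr_z n L m (sel \<omega>) k i) \<le> 1"
      using pr_z_nonneg[of "sel \<omega>", OF sel] pr_z_le_1[of "sel \<omega>", OF sel assms] by simp
  qed
qed (rule pr_z_measurable)

lemma integrable_S: "integrable M (S k)"
  unfolding S_def w_def
  by (intro Bochner_Integration.integrable_sum Bochner_Integration.integrable_add
      Bochner_Integration.integrable_diff integrable_pr_x integrable_pr_z) auto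

section \<open>Independence and the expected potential\<close>

text \<open>The two variables are functions of the selections in the disjoint time blocks
  \<open>{..<k}\<close> and \<open>{k}\<close>.\<close>

lemma indep_var_pr_z_th:
  "indep_var borel (\<lambda>\<omega>. pr_z n L m (sel \<omega>) k j) borel (\<lambda>\<omega>. indicator {j} (th k \<omega>) :: real)"
proof -
  let ?C = "\<lambda>_::nat. count_space UNIV :: nat measure"
  let ?F = "\<lambda>f. pr_z n L m f k j" and ?G = "\<lambda>f. indicator {j} (f k) :: real"
  have "indep_var (PiM {..<k} ?C) (\<lambda>\<omega>. restrict (\<lambda>t. th t \<omega>) {..<k})
      (PiM {k} ?C) (\<lambda>\<omega>. restrict (\<lambda>t. th t \<omega>) {k})"
    by (rule indep_var_restrict[OF th_indep_vars]) auto
  moreover have "?F \<in> borel_measurable (PiM {..<k} ?C)"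
    by (rule measurable_pr_state) auto
  moreover have "?G \<in> borel_measurable (PiM {k} ?C)"
    by (rule measurable_compose[where N="count_space UNIV"]) auto
  ultimately have "indep_var borel (?F \<circ> (\<lambda>\<omega>. restrict (\<lambda>t. th t \<omega>) {..<k}))
      borel (?G \<circ> (\<lambda>\<omega>. restrict (\<lambda>t. th t \<omega>) {k}))"
    by (rule indep_var_compose)
  \<comment> \<open>The restriction alters the sequence only from time \<open>k\<close> on, which
    the state at time \<open>k\<close> never reads.\<close>
  moreover have "?F \<circ> (\<lambda>\<omega>. restrict (\<lambda>t. th t \<omega>) {..<k}) = (\<lambda>\<omega>. pr_z n L m (sel \<omega>) k j)"
    by (auto simp: fun_eq_iff intro!: arg_cong[where f="\<lambda>s. snd s j"] pr_state_cong)
  ultimately show ?thesis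
    by (simp add: comp_def)
qed

lemma expectation_indicator_th:
  assumes "j < n"
  shows "expectation (\<lambda>\<omega>. indicator {j} (th k \<omega>) :: real) = 1 / real n"
proof -
  have "expectation (\<lambda>\<omega>. indicator {j} (th k \<omega>) :: real)
      = expectation (indicator {\<omega> \<in> space M. th k \<omega> = j})"
    by (rule Bochner_Integration.integral_cong) (auto simp: indicator_def)
  also have "\<dots> = 1 / real n"
    using th_uniform[OF assms] by (simp add: Int_def conj_commute cong: conj_cong)
  finally show ?thesis .
qed

lemma integrable_indicator_th: "integrable M (\<lambda>\<omega>. indicator {j} (th k \<omega>) :: real)"
proof (rule integrable_const_bound[where B=1])
  show "(\<lambda>\<omega>. indicator {j} (th k \<omega>) :: real) \<in> borel_measurable M"
    by (rule measurable_compose[OF th_measurable]) simp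
qed (auto simp: indicator_def)

lemma expectation_pr_z_selected:
  "expectation (\<lambda>\<omega>. pr_z n L m (sel \<omega>) k (th k \<omega>)) = m / real n * expectation (S k)"
proof -
  \<comment> \<open>Splitting by the selected page replaces the random index by fixed indices, so
    that independence factors each summand.\<close>
  have "expectation (\<lambda>\<omega>. pr_z n L m (sel \<omega>) k (th k \<omega>))
      = expectation (\<lambda>\<omega>. \<Sum>j<n. pr_z n L m (sel \<omega>) k j * indicator {j} (th k \<omega>))"
    by (rule Bochner_Integration.integral_cong)
      (auto simp: indicator_def th_less_n if_distrib cong: if_cong)
  also have "\<dots> = (\<Sum>j<n. expectation (\<lambda>\<omega>. pr_z n L m (sel \<omega>) k j * indicator {j} (th k \<omega>)))"
    by (intro Bochner_Integration.integral_sum indep_var_integrable[OF indep_var_pr_z_th]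
        integrable_pr_z integrable_indicator_th) simp
  also have "\<dots> = (\<Sum>j<n. expectation (\<lambda>\<omega>. pr_z n L m (sel \<omega>) k j) * (1 / real n))"
    by (intro sum.cong refl, subst indep_var_lebesgue_integral[OF indep_var_pr_z_th])
      (auto simp: integrable_pr_z integrable_indicator_th expectation_indicator_th)
  also have "\<dots> = expectation (\<lambda>\<omega>. \<Sum>j<n. pr_z n L m (sel \<omega>) k j) / real n"
    by (subst Bochner_Integration.integral_sum) (auto simp: integrable_pr_z sum_divide_distrib)
  also have "expectation (\<lambda>\<omega>. \<Sum>j<n. pr_z n L m (sel \<omega>) k j) = expectation (\<lambda>\<omega>. m * S k \<omega>)"
    unfolding S_def by (intro Bochner_Integration.integral_cong sum_pr_z th_less_n refl)
  finally show ?thesis by simp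
qed

lemma expectation_S: "expectation (S k) = (1 - m / real n) ^ k"
proof (induction k)
  case 0
  then show ?case by (simp add: S_def sum_w_0 prob_space)
next
  case (Suc k)
  \<comment> \<open>The selected entry of \<open>z\<close> is exactly the drop of the potential, so
    its mean \<open>m / n * expectation (S k)\<close> gives the recursion.\<close>
  have eq: "pr_z n L m (sel \<omega>) k (th k \<omega>) = S k \<omega> - S (Suc k) \<omega>" if "\<omega> \<in> space M" for \<omega>
    using that by (simp add: S_def sum_w_Suc th_less_n)
  have "expectation (\<lambda>\<omega>. pr_z n L m (sel \<omega>) k (th k \<omega>)) = expectation (\<lambda>\<omega>. S k \<omega> - S (Suc k) \<omega>)"
    by (intro Bochner_Integration.integral_cong eq refl)
  also have "\<dots> = expectation (S k) - expectation (S (Suc k))"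
    by (intro Bochner_Integration.integral_diff integrable_S)
  finally show ?case
    using Suc by (simp add: expectation_pr_z_selected algebra_simps)
qed

lemma rate_bounds: "0 < 1 - m / real n" "1 - m / real n < 1"
  using n_pos m_pos m_less_1 by (auto simp: field_simps)

section \<open>Almost sure convergence and the exponential rate\<close>

text \<open>The means form a convergent geometric series and \<open>S\<close> is nonnegative.
  Exchanging sum and integral shows that the series of the \<open>S k\<close> has finite mean, so it
  converges almost surely and its terms tend to 0.\<close>

lemma AE_S_tendsto_0: "AE \<omega> in M. (\<lambda>k. S k \<omega>) \<longlonglongrightarrow> 0"
proof -
  let ?\<rho> = "1 - m / real n"
  have nn: "(\<integral>\<^sup>+\<omega>. ennreal (S k \<omega>) \<partial>M) = ennreal (?\<rho> ^ k)" for k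
    using nn_integral_eq_integral[OF integrable_S[of k]] S_nonneg by (simp add: expectation_S)
  have "(\<integral>\<^sup>+\<omega>. (\<Sum>k. ennreal (S k \<omega>)) \<partial>M) = (\<Sum>k. ennreal (?\<rho> ^ k))"
    by (subst nn_integral_suminf) (simp_all add: nn)
  also have "\<dots> = ennreal (\<Sum>k. ?\<rho> ^ k)"
    using rate_bounds by (intro suminf_ennreal2 summable_geometric) auto
  finally have "(\<integral>\<^sup>+\<omega>. (\<Sum>k. ennreal (S k \<omega>)) \<partial>M) \<noteq> \<infinity>"
    by simp
  then have "AE \<omega> in M. (\<Sum>k. ennreal (S k \<omega>)) \<noteq> \<infinity>"
    by (intro nn_integral_PInf_AE) auto
  then show ?thesis
    by (rule AE_mp) (auto intro!: AE_I2 summable_LIMSEQ_zero summable_suminf_not_top S_nonneg)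
qed

lemma AE_pr_x_tendsto: "AE \<omega> in M. \<forall>i<n. (\<lambda>k. pr_x n L m (sel \<omega>) k i) \<longlonglongrightarrow> xs i"
  using AE_S_tendsto_0
proof (rule AE_mp, intro AE_I2 impI allI)
  fix \<omega> i
  assume \<omega>: "\<omega> \<in> space M" and S: "(\<lambda>k. S k \<omega>) \<longlonglongrightarrow> 0" and i: "i < n"
  show "(\<lambda>k. pr_x n L m (sel \<omega>) k i) \<longlonglongrightarrow> xs i"
  proof (rule tendsto_sandwich)
    show "(\<lambda>k. xs i - S k \<omega>) \<longlonglongrightarrow> xs i"
      using tendsto_diff[OF tendsto_const S, of "xs i"] by simp
    show "\<forall>\<^sub>F k in sequentially. xs i - S k \<omega> \<le> pr_x n L m (sel \<omega>) k i"
      using error_le_sum_w[of "sel \<omega>" i] th_less_n[OF \<omega>] i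
      by (auto simp: S_def algebra_simps)
    show "\<forall>\<^sub>F k in sequentially. pr_x n L m (sel \<omega>) k i \<le> xs i"
      using pr_x_le_pagerank[of "sel \<omega>" i] th_less_n[OF \<omega>] i by auto
  qed simp
qed

text \<open>Pointwise \<open>0 \<le> xs i - x \<le> S k\<close>; the lower bound fixes the sign of
  the mean error and the upper one bounds its size.\<close>

lemma expectation_error_bound:
  assumes "i < n"
  shows "\<bar>expectation (\<lambda>\<omega>. pr_x n L m (sel \<omega>) k i) - xs i\<bar> \<le> (1 - m / real n) ^ k"
proof -
  have "expectation (\<lambda>\<omega>. pr_x n L m (sel \<omega>) k i) \<le> expectation (\<lambda>\<omega>. xs i)"
    by (intro integral_mono integrable_pr_x integrable_const pr_x_le_pagerank th_less_n assms)
  moreover have "expectation (\<lambda>\<omega>. xs i - pr_x n L m (sel \<omega>) k i) \<le> expectation (S k)"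
    using error_le_sum_w th_less_n assms
    by (intro integral_mono integrable_S Bochner_Integration.integrable_diff
        integrable_pr_x integrable_const) (auto simp: S_def)
  ultimately show ?thesis
    using assms by (simp add: expectation_S integrable_pr_x prob_space)
qed

lemma expectation_pr_x_tendsto:
  assumes "i < n"
  shows "(\<lambda>k. expectation (\<lambda>\<omega>. pr_x n L m (sel \<omega>) k i)) \<longlonglongrightarrow> xs i"
proof (rule LIM_zero_cancel, rule Lim_null_comparison)
  show "\<forall>\<^sub>F k in sequentially.
      norm (expectation (\<lambda>\<omega>. pr_x n L m (sel \<omega>) k i) - xs i) \<le> (1 - m / real n) ^ k"
    using expectation_error_bound[OF assms] by simp
  show "(\<lambda>k. (1 - m / real n) ^ k) \<longlonglongrightarrow> 0"
    using rate_bounds by (intro LIMSEQ_power_zero) simp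
qed

text \<open>The Euclidean norm is at most the sum of absolute values; the factor \<open>n\<close>
  counts the entries.\<close>

lemma norm_expectation_error_bound:
  "sqrt (\<Sum>i<n. (expectation (\<lambda>\<omega>. pr_x n L m (sel \<omega>) k i) - xs i)\<^sup>2)
    \<le> real n * (1 - m / real n) ^ k"
proof -
  have "sqrt (\<Sum>i<n. (expectation (\<lambda>\<omega>. pr_x n L m (sel \<omega>) k i) - xs i)\<^sup>2)
      \<le> (\<Sum>i<n. \<bar>expectation (\<lambda>\<omega>. pr_x n L m (sel \<omega>) k i) - xs i\<bar>)"
    using L2_set_le_sum_abs by (simp add: L2_set_def)
  also have "\<dots> \<le> (\<Sum>i<n. (1 - m / real n) ^ k)"
    by (intro sum_mono expectation_error_bound) simp
  finally show ?thesis by simp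
qed

end

theorem theorem1:
  fixes n :: nat and L :: "nat \<Rightarrow> nat set" and m :: real
    and xs :: "nat \<Rightarrow> real"
    and M :: "'a measure" and th :: "nat \<Rightarrow> 'a \<Rightarrow> nat"
  assumes n2: "n \<ge> 2"
    and L_sub: "\<And>j. j < n \<Longrightarrow> L j \<subseteq> {..<n}"
    and L_ne: "\<And>j. j < n \<Longrightarrow> L j \<noteq> {}"
    and no_self: "\<And>j. j < n \<Longrightarrow> j \<notin> L j"
    and m: "0 < m" "m < 1"
    and pagerank: "\<And>i. i < n \<Longrightarrow> xs i = (1 - m) * (\<Sum>j<n. hyperlink L i j * xs j) + m / real n"
    and pagerank_sum: "(\<Sum>i<n. xs i) = 1"
    and P: "prob_space M"
    and th_meas: "\<And>k. th k \<in> measurable M (count_space UNIV)"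
    and th_range: "\<And>k \<omega>. \<omega> \<in> space M \<Longrightarrow> th k \<omega> < n"
    and th_indep: "prob_space.indep_vars M (\<lambda>_. count_space UNIV) th UNIV"
    and th_unif: "\<And>k i. i < n \<Longrightarrow> measure M {\<omega> \<in> space M. th k \<omega> = i} = 1 / real n"
  shows "(AE \<omega> in M. \<forall>i<n. (\<lambda>k. pr_x n L m (\<lambda>t. th t \<omega>) k i) \<longlonglongrightarrow> xs i)
    \<and> (\<forall>\<omega>\<in>space M. \<forall>k. \<forall>i<n.
          pr_x n L m (\<lambda>t. th t \<omega>) k i \<le> pr_x n L m (\<lambda>t. th t \<omega>) (Suc k) i
        \<and> pr_x n L m (\<lambda>t. th t \<omega>) (Suc k) i \<le> xs i)
    \<and> (\<forall>i<n. (\<lambda>k. prob_space.expectation M (\<lambda>\<omega>. pr_x n L m (\<lambda>t. th t \<omega>) k i)) \<longlonglongrightarrow> xs i)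
    \<and> (\<exists>C \<rho>. C > 0 \<and> 0 < \<rho> \<and> \<rho> < 1 \<and> (\<forall>k.
          sqrt (\<Sum>i<n. (prob_space.expectation M (\<lambda>\<omega>. pr_x n L m (\<lambda>t. th t \<omega>) k i) - xs i)\<^sup>2)
            \<le> C * \<rho> ^ k))"
proof -
  interpret random_pagerank n L m xs M th
    by (intro random_pagerank.intro pagerank_graph.intro random_pagerank_axioms.intro)
      (use assms in auto)
  have "\<exists>C \<rho>. C > 0 \<and> 0 < \<rho> \<and> \<rho> < 1 \<and> (\<forall>k.
      sqrt (\<Sum>i<n. (expectation (\<lambda>\<omega>. pr_x n L m (\<lambda>t. th t \<omega>) k i) - xs i)\<^sup>2) \<le> C * \<rho> ^ k)"
    using norm_expectation_error_bound rate_bounds n_pos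
    by (intro exI[of _ "real n"] exI[of _ "1 - m / real n"]) simp
  moreover have "pr_x n L m (sel \<omega>) k i \<le> pr_x n L m (sel \<omega>) (Suc k) i
      \<and> pr_x n L m (sel \<omega>) (Suc k) i \<le> xs i" if "\<omega> \<in> space M" "i < n" for \<omega> k i
    by (intro conjI pr_x_mono pr_x_le_pagerank th_less_n that)
  ultimately show ?thesis
    using AE_pr_x_tendsto expectation_pr_x_tendsto by blast
qed

end
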